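(* Consider the one-way scheme described in the context, with codebook $\mathcal C\subseteq\mathbb R^n$ of size $2^k$, coloring $\chi$ with $2^c$ colors, and thresholds $t,s$. Then the min-entropy of Alice's output is at least $-\log_2(\mathcal U+2^{-k})$. Moreover, if $|\mathcal C|\cdot\mathcal T_A\le\tfrac14$ and $|\mathcal C|\cdot\mathcal T_B\le\tfrac14\cdot 2^c$, then the probability that Alice and Bob output the same $k$-bit string is at least $\tfrac12|\mathcal C|\cdot\mathcal B$.
   Context: Let $\mu$ be a distribution on $\mathbb R\times\mathbb R$ and let $(X,Y)$ with $X,Y\in\mathbb R^n$ consist of $n$ i.i.d. samples $(X_i,Y_i)\sim\mu$; Alice gets $X$, Bob gets $Y$. Let $\mathcal C\subseteq\mathbb R^n$ be a codebook with $|\mathcal C|=2^k$, each codeword having a distinct $k$-bit encoding. Let $c\ge0$ and let $\chi$ be a coloring of $\mathcal C$ with $2^c$ colors such that each color class has size at most $|\mathcal C|2^{-c}+1$; let $\diamond$ be an additional auxiliary color. Let $t,s$ be real parameters and let $\kappa_A,\kappa_B$ be maps into $\{0,1\}^k$ such that $\kappa_A(X)$ and $\kappa_B(Y)$ are each uniformly distributed on $\{0,1\}^k$. The scheme: if there is a unique $v\in\mathcal C$ with $\langle v,X\rangle>t$, Alice outputs (the encoding of) $v$ and sends $\chi(v)$; otherwise Alice outputs $\kappa_A(X)$ and sends $\diamond$. Bob, having received color $\tau$, outputs (the encoding of) $w$ if there is a unique $w\in\mathcal C$ with $\chi(w)=\tau$ and $\langle w,Y\rangle>s$, and otherwise outputs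 $\kappa_B(Y)$. Define $\mathcal U=\max_{v\in\mathcal C}\Pr[\langle v,X\rangle>t]$; $\mathcal B=\min_{v\in\mathcal C}\Pr[\langle v,X\rangle>t,\langle v,Y\rangle>s]$; $\mathcal T_A=\max_{v\ne w\in\mathcal C}\Pr[\langle w,X\rangle>t\mid\langle v,X\rangle>t,\langle v,Y\rangle>s]$; $\mathcal T_B=\max_{v\ne w\in\mathcal C}\Pr[\langle w,Y\rangle>s\mid\langle v,X\rangle>t,\langle v,Y\rangle>s]$. Min-entropy of a random variable $K$ is $-\log_2\max_a\Pr[K=a]$. *)

theory Defs
  imports "HOL-Probability.Probability"
begin

definition bitstrings :: "nat \<Rightarrow> bool list set" where
  "bitstrings k = {bs. length bs = k}"

text \<open>Min-entropy of a random variable \<open>K\<close> with values in the finite alphabet \<open>A\<close>.\<close>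

definition min_entropy :: "'a measure \<Rightarrow> 'b set \<Rightarrow> ('a \<Rightarrow> 'b) \<Rightarrow> real" where
  "min_entropy M A K = - log 2 (Max ((\<lambda>a. \<P>(\<omega> in M. K \<omega> = a)) ` A))"

definition uniform_rv :: "'a measure \<Rightarrow> 'b set \<Rightarrow> ('a \<Rightarrow> 'b) \<Rightarrow> bool" where
  "uniform_rv M A K \<longleftrightarrow>
     K \<in> measurable M (count_space A) \<and> distr M (count_space A) K = uniform_count_measure A"

text \<open>
  In the scheme below, the message \<open>Some \<tau>\<close> is the colour \<open>\<tau>\<close> and \<open>None\<close> is the auxiliary
  colour, which is different from all colours of codewords.
\<close>

definition alice_output ::
  "(real^'n) set \<Rightarrow> (real^'n \<Rightarrow> bool list) \<Rightarrow> real \<Rightarrow> (real^'n \<Rightarrow> bool list) \<Rightarrow> real^'n \<Rightarrow> bool list" where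
  "alice_output C enc t \<kappa>A x =
     (if \<exists>!v. v \<in> C \<and> inner v x > t then enc (THE v. v \<in> C \<and> inner v x > t) else \<kappa>A x)"

definition alice_message ::
  "(real^'n) set \<Rightarrow> (real^'n \<Rightarrow> 'c) \<Rightarrow> real \<Rightarrow> real^'n \<Rightarrow> 'c option" where
  "alice_message C col t x =
     (if \<exists>!v. v \<in> C \<and> inner v x > t then Some (col (THE v. v \<in> C \<and> inner v x > t)) else None)"

definition bob_output ::
  "(real^'n) set \<Rightarrow> (real^'n \<Rightarrow> bool list) \<Rightarrow> (real^'n \<Rightarrow> 'c) \<Rightarrow> real \<Rightarrow> (real^'n \<Rightarrow> bool list)
     \<Rightarrow> 'c option \<Rightarrow> real^'n \<Rightarrow> bool list" where
  "bob_output C enc col s \<kappa>B \<tau> y =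
     (if \<exists>!w. w \<in> C \<and> Some (col w) = \<tau> \<and> inner w y > s
      then enc (THE w. w \<in> C \<and> Some (col w) = \<tau> \<and> inner w y > s) else \<kappa>B y)"

definition U_par :: "'a measure \<Rightarrow> ('a \<Rightarrow> real^'n) \<Rightarrow> (real^'n) set \<Rightarrow> real \<Rightarrow> real" where
  "U_par M X C t = Max ((\<lambda>v. \<P>(\<omega> in M. inner v (X \<omega>) > t)) ` C)"

definition B_par ::
  "'a measure \<Rightarrow> ('a \<Rightarrow> real^'n) \<Rightarrow> ('a \<Rightarrow> real^'n) \<Rightarrow> (real^'n) set \<Rightarrow> real \<Rightarrow> real \<Rightarrow> real" where
  "B_par M X Y C t s =
     Min ((\<lambda>v. \<P>(\<omega> in M. inner v (X \<omega>) > t \<and> inner v (Y \<omega>) > s)) ` C)"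

text \<open>
  The element \<open>0\<close> is inserted so that the maximum is \<open>0\<close> if \<open>C\<close> is a singleton and there is no pair
  \<open>v \<noteq> w\<close>; otherwise it is irrelevant, since probabilities are nonnegative.  A conditional
  probability given a null event is \<open>0\<close>.
\<close>

definition TA_par ::
  "'a measure \<Rightarrow> ('a \<Rightarrow> real^'n) \<Rightarrow> ('a \<Rightarrow> real^'n) \<Rightarrow> (real^'n) set \<Rightarrow> real \<Rightarrow> real \<Rightarrow> real" where
  "TA_par M X Y C t s =
     Max (insert 0 {\<P>(\<omega> in M. inner w (X \<omega>) > t \<bar> inner v (X \<omega>) > t \<and> inner v (Y \<omega>) > s)
                    | v w. v \<in> C \<and> w \<in> C \<and> v \<noteq> w})"

definition TB_par ::
  "'a measure \<Rightarrow> ('a \<Rightarrow> real^'n) \<Rightarrow> ('a \<Rightarrow> real^'n) \<Rightarrow> (real^'n) set \<Rightarrow> real \<Rightarrow> real \<Rightarrow> real" where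
  "TB_par M X Y C t s =
     Max (insert 0 {\<P>(\<omega> in M. inner w (Y \<omega>) > s \<bar> inner v (X \<omega>) > t \<and> inner v (Y \<omega>) > s)
                    | v w. v \<in> C \<and> w \<in> C \<and> v \<noteq> w})"

end

theory Submission
  imports Defs
begin

text \<open>
  Alice's output can equal the encoding of a codeword \<open>v\<close> only if \<open>\<langle>v, X\<rangle> > t\<close> or if the fallback
  key takes that value, which gives the min-entropy bound.  For the agreement probability, the
  events \<open>E v = {\<langle>v, X\<rangle> > t, \<langle>v, Y\<rangle> > s}\<close>, with all confusions of \<open>v\<close> with another codeword removed,
  are disjoint and contained in the agreement event.  By the union bound each removal costs at most
  the fraction \<open>1/4\<close> of \<open>E v\<close> on Alice's side, and the same on Bob's side, where only the at most
  \<open>|C| 2\<^sup>-\<^sup>c\<close> other codewords of the same colour matter.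
\<close>

section \<open>Finite alphabets and measurable choice of a unique element\<close>

lemma finite_bitstrings: "finite (bitstrings k)"
  using finite_lists_length_eq[of "UNIV :: bool set" k] by (simp add: bitstrings_def)

lemma card_bitstrings: "card (bitstrings k) = 2 ^ k"
  using card_lists_length_eq[of "UNIV :: bool set" k] by (simp add: bitstrings_def)

lemma finite_image_distinct_pairs:
  assumes "finite C"
  shows "finite {F v w | v w. v \<in> C \<and> w \<in> C \<and> v \<noteq> w}"
  by (rule finite_subset[of _ "(\<lambda>(v, w). F v w) ` (C \<times> C)"]) (use assms in auto)

text \<open>Trades the definite description for quantifiers bounded by \<open>C\<close>. With
  \<open>C\<close> finite these preserve measurability, and the same form evaluates both outputs and
  the message pointwise.\<close>

lemma unique_choice_eq_iff:
  "(if \<exists>!v. v \<in> C \<and> P v then f (THE v. v \<in> C \<and> P v) else d) = a \<longleftrightarrow>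
     (\<exists>v\<in>C. f v = a \<and> P v \<and> (\<forall>w\<in>C. P w \<longrightarrow> w = v)) \<or>
     \<not> (\<exists>v\<in>C. P v \<and> (\<forall>w\<in>C. P w \<longrightarrow> w = v)) \<and> d = a"
proof (cases "\<exists>!v. v \<in> C \<and> P v")
  case True
  then obtain u where u: "u \<in> C" "P u" "\<And>w. w \<in> C \<Longrightarrow> P w \<Longrightarrow> w = u" by blast
  then have "(THE v. v \<in> C \<and> P v) = u" by blast
  \<comment> \<open>As \<open>u\<close> is the only witness, the bounded existential evaluates
    \<open>Q\<close> at \<open>u\<close>. The trivial \<open>Q\<close> gives the existence of a
    witness, which excludes the second disjunct.\<close>
  moreover have "(\<exists>v\<in>C. Q v \<and> P v \<and> (\<forall>w\<in>C. P w \<longrightarrow> w = v)) \<longleftrightarrow> Q u" for Q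
    using u by blast
  from this[of "\<lambda>v. f v = a"] this[of "\<lambda>_. True"]
  have "(\<exists>v\<in>C. f v = a \<and> P v \<and> (\<forall>w\<in>C. P w \<longrightarrow> w = v)) \<longleftrightarrow> f u = a"
    "\<exists>v\<in>C. P v \<and> (\<forall>w\<in>C. P w \<longrightarrow> w = v)" by simp_all
  ultimately show ?thesis using True by simp
next
  case False
  then have "\<not> (\<exists>v\<in>C. P v \<and> (\<forall>w\<in>C. P w \<longrightarrow> w = v))" by blast
  with False show ?thesis by auto
qed

text \<open>Alice's output, her message and Bob's output all have this shape. The target is finite,
  so preimages of points suffice, and each is a finite Boolean combination of the events
  \<open>P v\<close> and \<open>g = a\<close>.\<close>

lemma measurable_unique_choice:
  assumes "finite C" and A: "finite A"
    and P: "\<And>v. v \<in> C \<Longrightarrow> Measurable.pred M (P v)"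
    and f: "f ` C \<subseteq> A" and g: "g \<in> measurable M (count_space A)"
  shows "(\<lambda>\<omega>. if \<exists>!v. v \<in> C \<and> P v \<omega> then f (THE v. v \<in> C \<and> P v \<omega>) else g \<omega>)
           \<in> measurable M (count_space A)" (is "?h \<in> _")
proof (subst measurable_count_space_eq2[OF A], intro conjI ballI)
  show "?h \<in> space M \<rightarrow> A"
  proof
    fix \<omega> assume "\<omega> \<in> space M"
    then have "g \<omega> \<in> A" using measurable_space[OF g] by simp
    moreover have "f (THE v. v \<in> C \<and> P v \<omega>) \<in> A" if "\<exists>!v. v \<in> C \<and> P v \<omega>"
      using theI'[OF that] f by blast
    ultimately show "?h \<omega> \<in> A" by simp
  qed
next
  fix a assume "a \<in> A"
  have ga: "Measurable.pred M (\<lambda>\<omega>. g \<omega> = a)"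
    using g by measurable
  have "Measurable.pred M (\<lambda>\<omega>. ?h \<omega> = a)"
    unfolding unique_choice_eq_iff[where f=f]
    using \<open>finite C\<close> by (intro pred_intros_logic pred_intros_finite P ga) auto
  then show "?h -` {a} \<inter> space M \<in> sets M"
    by (simp add: pred_def vimage_def Int_def conj_commute)
qed

text \<open>Equality splits into finitely many cases, one for each common value; that
  \<open>f\<close> maps into \<open>A\<close> makes the cases exhaustive.\<close>

lemma pred_eq_count_space:
  assumes "finite A" "f \<in> measurable M (count_space A)" "g \<in> measurable M (count_space A)"
  shows "Measurable.pred M (\<lambda>\<omega>. f \<omega> = g \<omega>)"
proof -
  have "Measurable.pred M (\<lambda>\<omega>. \<exists>a\<in>A. f \<omega> = a \<and> g \<omega> = a)"
    using assms(1)
  proof (intro pred_intros_finite pred_intros_logic)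
    note [measurable] = assms(2,3)
    show "Measurable.pred M (\<lambda>\<omega>. f \<omega> = a)" "Measurable.pred M (\<lambda>\<omega>. g \<omega> = a)" for a
      by measurable
  qed
  moreover have "f \<omega> \<in> A" if "\<omega> \<in> space M" for \<omega>
    using measurable_space[OF assms(2) that] by simp
  ultimately show ?thesis
    by (subst measurable_cong) auto
qed

section \<open>Uniform keys, union bounds and min-entropy\<close>

lemma prob_uniform_rv:
  assumes "uniform_rv M A K" "finite A" "a \<in> A"
  shows "\<P>(\<omega> in M. K \<omega> = a) = 1 / real (card A)"
proof -
  have K: "K \<in> measurable M (count_space A)"
    and d: "distr M (count_space A) K = uniform_count_measure A"
    using assms(1) by (auto simp: uniform_rv_def)
  have "\<P>(\<omega> in M. K \<omega> = a) = measure (distr M (count_space A) K) {a}"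
    using assms by (subst measure_distr[OF K]) (auto intro!: arg_cong[where f="measure M"])
  also have "\<dots> = 1 / real (card A)"
    unfolding d using assms by (simp add: measure_uniform_count_measure)
  finally show ?thesis .
qed

lemma (in prob_space) prob_conj_le_cond_prob:
  assumes [measurable]: "Measurable.pred M P" "Measurable.pred M Q"
    and "cond_prob M P Q \<le> T"
  shows "\<P>(\<omega> in M. Q \<omega> \<and> P \<omega>) \<le> T * \<P>(\<omega> in M. Q \<omega>)"
proof (cases "\<P>(\<omega> in M. Q \<omega>) = 0")
  \<comment> \<open>The quotient defining \<open>cond_prob\<close> carries no information on a null
    event; there both sides vanish by monotonicity.\<close>
  case True
  have "\<P>(\<omega> in M. Q \<omega> \<and> P \<omega>) \<le> \<P>(\<omega> in M. Q \<omega>)"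
    by (intro finite_measure_mono) auto
  with True show ?thesis by simp
next
  case False
  then have "\<P>(\<omega> in M. Q \<omega>) > 0" by (simp add: zero_less_measure_iff)
  with assms(3) show ?thesis
    by (simp add: cond_prob_def field_simps conj_commute)
qed

text \<open>Union bound over the confusing codewords. Keeping the factor \<open>card W\<close>
  explicit lets Alice count all other codewords and Bob only those of the same colour.\<close>

lemma (in prob_space) prob_conj_Bex_le:
  assumes "finite W" and [measurable]: "Measurable.pred M Q"
    and P: "\<And>w. w \<in> W \<Longrightarrow> Measurable.pred M (P w)"
    and T: "\<And>w. w \<in> W \<Longrightarrow> cond_prob M (P w) Q \<le> T"
  shows "\<P>(\<omega> in M. Q \<omega> \<and> (\<exists>w\<in>W. P w \<omega>)) \<le> real (card W) * T * \<P>(\<omega> in M. Q \<omega>)"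
proof -
  have "\<P>(\<omega> in M. Q \<omega> \<and> (\<exists>w\<in>W. P w \<omega>)) = prob (\<Union>w\<in>W. {\<omega>\<in>space M. Q \<omega> \<and> P w \<omega>})"
    by (intro arg_cong[where f=prob]) auto
  also have "\<dots> \<le> (\<Sum>w\<in>W. \<P>(\<omega> in M. Q \<omega> \<and> P w \<omega>))"
    using assms(1)
  proof (intro finite_measure_subadditive_finite image_subsetI)
    fix w assume "w \<in> W"
    note [measurable] = P[OF this]
    show "{\<omega>\<in>space M. Q \<omega> \<and> P w \<omega>} \<in> events" by measurable
  qed
  also have "\<dots> \<le> (\<Sum>w\<in>W. T * \<P>(\<omega> in M. Q \<omega>))"
    by (intro sum_mono prob_conj_le_cond_prob P T assms(2))
  finally show ?thesis by simp
qed

lemma (in prob_space) prob_conj_not_not_ge: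
  assumes [measurable]: "Measurable.pred M Q" "Measurable.pred M P" "Measurable.pred M R"
  shows "\<P>(\<omega> in M. Q \<omega> \<and> \<not> P \<omega> \<and> \<not> R \<omega>)
           \<ge> \<P>(\<omega> in M. Q \<omega>) - \<P>(\<omega> in M. Q \<omega> \<and> P \<omega>) - \<P>(\<omega> in M. Q \<omega> \<and> R \<omega>)"
proof -
  have "\<P>(\<omega> in M. Q \<omega>) \<le> prob ({\<omega>\<in>space M. Q \<omega> \<and> \<not> P \<omega> \<and> \<not> R \<omega>} \<union>
          ({\<omega>\<in>space M. Q \<omega> \<and> P \<omega>} \<union> {\<omega>\<in>space M. Q \<omega> \<and> R \<omega>}))"
    by (intro finite_measure_mono) (blast, measurable)
  also have "\<dots> \<le> \<P>(\<omega> in M. Q \<omega> \<and> \<not> P \<omega> \<and> \<not> R \<omega>) +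
      prob ({\<omega>\<in>space M. Q \<omega> \<and> P \<omega>} \<union> {\<omega>\<in>space M. Q \<omega> \<and> R \<omega>})"
    by (intro measure_Un_le) auto
  also have "prob ({\<omega>\<in>space M. Q \<omega> \<and> P \<omega>} \<union> {\<omega>\<in>space M. Q \<omega> \<and> R \<omega>})
      \<le> \<P>(\<omega> in M. Q \<omega> \<and> P \<omega>) + \<P>(\<omega> in M. Q \<omega> \<and> R \<omega>)"
    by (intro measure_Un_le) auto
  finally show ?thesis by simp
qed

lemma (in prob_space) min_entropy_ge:
  assumes A: "finite A" and K: "K \<in> measurable M (count_space A)"
    and p: "\<And>a. a \<in> A \<Longrightarrow> \<P>(\<omega> in M. K \<omega> = a) \<le> p"
  shows "min_entropy M A K \<ge> - log 2 p"
proof -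
  let ?m = "Max ((\<lambda>a. \<P>(\<omega> in M. K \<omega> = a)) ` A)"
  have KA: "K \<omega> \<in> A" if "\<omega> \<in> space M" for \<omega>
    using measurable_space[OF K that] by simp
  then have ne: "A \<noteq> {}" using not_empty by blast
  have "1 = prob (\<Union>a\<in>A. {\<omega>\<in>space M. K \<omega> = a})"
    using KA prob_space by (subst arg_cong[where f=prob and y="space M"]) auto
  also have "\<dots> \<le> (\<Sum>a\<in>A. \<P>(\<omega> in M. K \<omega> = a))"
    using A K by (intro finite_measure_subadditive_finite image_subsetI) (auto, measurable)
  also have "\<dots> \<le> (\<Sum>a\<in>A. ?m)"
    using A by (intro sum_mono Max_ge) auto
  finally have "1 \<le> real (card A) * ?m" by simp
  \<comment> \<open>Some value is always taken, so the point probabilities sum to at least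
    \<open>1\<close> and their maximum cannot be nonpositive. Positivity is what makes the logarithm
    monotone here.\<close>
  then have "?m > 0"
    by (smt (verit) mult_nonneg_nonpos of_nat_0_le_iff)
  moreover have "?m \<le> p"
    using A ne p by (subst Max_le_iff) auto
  ultimately show ?thesis
    by (simp add: min_entropy_def)
qed

section \<open>From coordinate pairs to vectors, and pointwise agreement\<close>

lemma borel_measurable_vec_pair:
  fixes X Y :: "'a \<Rightarrow> real^'n"
  assumes "\<And>i. (\<lambda>\<omega>. (X \<omega> $ i, Y \<omega> $ i)) \<in> borel_measurable M"
  shows "X \<in> borel_measurable M" "Y \<in> borel_measurable M"
proof -
  have *: "(\<lambda>\<omega>. fst (X \<omega> $ i, Y \<omega> $ i)) \<in> borel_measurable M"
    "(\<lambda>\<omega>. snd (X \<omega> $ i, Y \<omega> $ i)) \<in> borel_measurable M" for i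
    by (rule measurable_compose[OF assms], simp add: borel_measurable_continuous_onI continuous_on_fst continuous_on_snd)+
  then show "X \<in> borel_measurable M" "Y \<in> borel_measurable M"
    by (auto simp: borel_measurable_euclidean_space[where 'c="real^'n"] Basis_vec_def inner_axis)
qed

text \<open>By \<open>A\<close>, Alice decodes \<open>v\<close> and sends its colour. Bob then
  compares only codewords of that colour, among which \<open>B\<close> leaves \<open>v\<close>
  alone, so both outputs are \<open>enc v\<close>.\<close>

lemma scheme_agrees:
  assumes v: "v \<in> C" "inner v x > t" "inner v y > s"
    and A: "\<not> (\<exists>w\<in>C - {v}. inner w x > t)"
    and B: "\<not> (\<exists>w\<in>{w \<in> C. col w = col v} - {v}. inner w y > s)"
  shows "alice_output C enc t \<kappa>A x = bob_output C enc col s \<kappa>B (alice_message C col t x) y"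
proof -
  have msg: "alice_message C col t x = Some (col v)"
    unfolding alice_message_def unique_choice_eq_iff[where f="\<lambda>v. Some (col v)"] using v A by blast
  have "alice_output C enc t \<kappa>A x = enc v"
    unfolding alice_output_def unique_choice_eq_iff[where f=enc] using v A by blast
  moreover have "bob_output C enc col s \<kappa>B (alice_message C col t x) y = enc v"
    unfolding msg bob_output_def unique_choice_eq_iff[where f=enc] using v B by auto
  ultimately show ?thesis by simp
qed

section \<open>Measurability and probability estimates for the scheme\<close>

locale one_way_scheme = prob_space M for M :: "'a measure" +
  fixes X Y :: "'a \<Rightarrow> real^'n"
    and C :: "(real^'n) set" and k :: nat and enc :: "real^'n \<Rightarrow> bool list"
    and col :: "real^'n \<Rightarrow> 'c"
    and t s :: real and \<kappa>A \<kappa>B :: "real^'n \<Rightarrow> bool list"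
  assumes X [measurable]: "X \<in> borel_measurable M"
    and Y [measurable]: "Y \<in> borel_measurable M"
    and C: "finite C" "C \<noteq> {}"
    and inj: "inj_on enc C"
    and enc: "enc ` C \<subseteq> bitstrings k"
    and \<kappa>A: "uniform_rv M (bitstrings k) (\<lambda>\<omega>. \<kappa>A (X \<omega>))"
    and \<kappa>B: "uniform_rv M (bitstrings k) (\<lambda>\<omega>. \<kappa>B (Y \<omega>))"
begin

lemma pred_gt [measurable]:
  "Measurable.pred M (\<lambda>\<omega>. inner v (X \<omega>) > t)" "Measurable.pred M (\<lambda>\<omega>. inner v (Y \<omega>) > s)"
  by measurable

lemma measurable_alice_output:
  "(\<lambda>\<omega>. alice_output C enc t \<kappa>A (X \<omega>)) \<in> measurable M (count_space (bitstrings k))"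
  unfolding alice_output_def
  by (rule measurable_unique_choice[where f=enc, OF C(1) finite_bitstrings pred_gt(1) enc])
     (use \<kappa>A in \<open>simp add: uniform_rv_def\<close>)

lemma measurable_alice_message:
  "(\<lambda>\<omega>. alice_message C col t (X \<omega>)) \<in> measurable M (count_space (insert None (Some ` col ` C)))"
  unfolding alice_message_def
  by (rule measurable_unique_choice[where f="\<lambda>v. Some (col v)", OF C(1) _ pred_gt(1)])
     (use C in auto)

lemma measurable_bob_output:
  "(\<lambda>\<omega>. bob_output C enc col s \<kappa>B (alice_message C col t (X \<omega>)) (Y \<omega>))
     \<in> measurable M (count_space (bitstrings k))"
  unfolding bob_output_def
proof (rule measurable_unique_choice[where f=enc, OF C(1) finite_bitstrings _ enc])
  fix w assume "w \<in> C"
  \<comment> \<open>Bob's test depends on the received message, hence on \<open>X\<close> as well as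
    \<open>Y\<close>; this is where the measurability of the message enters.\<close>
  have "Measurable.pred M (\<lambda>\<omega>. Some (col w) = alice_message C col t (X \<omega>))"
    using C \<open>w \<in> C\<close>
    by (intro pred_eq_count_space[OF _ _ measurable_alice_message]) auto
  then show "Measurable.pred M
      (\<lambda>\<omega>. Some (col w) = alice_message C col t (X \<omega>) \<and> inner w (Y \<omega>) > s)"
    by (intro pred_intros_logic pred_gt)
qed (use \<kappa>B in \<open>simp add: uniform_rv_def\<close>)

lemma prob_alice_output_le:
  assumes "a \<in> bitstrings k"
  shows "\<P>(\<omega> in M. alice_output C enc t \<kappa>A (X \<omega>) = a) \<le> U_par M X C t + 2 powr (- real k)"
proof -
  have [measurable]: "(\<lambda>\<omega>. \<kappa>A (X \<omega>)) \<in> measurable M (count_space (bitstrings k))"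
    using \<kappa>A by (simp add: uniform_rv_def)
  have meas: "Measurable.pred M (\<lambda>\<omega>. \<kappa>A (X \<omega>) = a)"
    by measurable
  \<comment> \<open>Injectivity leaves at most one codeword encoded as \<open>a\<close>. If there is
    none, any element of the nonempty \<open>C\<close> serves as \<open>v\<close>.\<close>
  obtain v where v: "v \<in> C" "\<And>w. w \<in> C \<Longrightarrow> enc w = a \<Longrightarrow> w = v"
    using C inj by (metis all_not_in_conv inj_onD)
  have "\<P>(\<omega> in M. alice_output C enc t \<kappa>A (X \<omega>) = a)
      \<le> prob ({\<omega>\<in>space M. inner v (X \<omega>) > t} \<union> {\<omega>\<in>space M. \<kappa>A (X \<omega>) = a})"
    unfolding alice_output_def unique_choice_eq_iff[where f=enc]
    using v meas by (intro finite_measure_mono) auto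
  also have "\<dots> \<le> \<P>(\<omega> in M. inner v (X \<omega>) > t) + \<P>(\<omega> in M. \<kappa>A (X \<omega>) = a)"
    using meas by (intro measure_Un_le) auto
  also have "\<P>(\<omega> in M. inner v (X \<omega>) > t) \<le> U_par M X C t"
    unfolding U_par_def using C v by (intro Max_ge) auto
  also have "\<P>(\<omega> in M. \<kappa>A (X \<omega>) = a) = 2 powr (- real k)"
    using prob_uniform_rv[OF \<kappa>A finite_bitstrings assms]
    by (simp add: card_bitstrings powr_minus powr_realpow divide_inverse)
  finally show ?thesis by simp
qed

lemma cond_prob_le_par:
  assumes "v \<in> C" "w \<in> C" "w \<noteq> v"
  shows "\<P>(\<omega> in M. inner w (X \<omega>) > t \<bar> inner v (X \<omega>) > t \<and> inner v (Y \<omega>) > s)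
           \<le> TA_par M X Y C t s"
    and "\<P>(\<omega> in M. inner w (Y \<omega>) > s \<bar> inner v (X \<omega>) > t \<and> inner v (Y \<omega>) > s)
           \<le> TB_par M X Y C t s"
proof -
  show "\<P>(\<omega> in M. inner w (X \<omega>) > t \<bar> inner v (X \<omega>) > t \<and> inner v (Y \<omega>) > s)
           \<le> TA_par M X Y C t s"
    unfolding TA_par_def using assms by (intro Max_ge) (auto simp: finite_image_distinct_pairs C)
  show "\<P>(\<omega> in M. inner w (Y \<omega>) > s \<bar> inner v (X \<omega>) > t \<and> inner v (Y \<omega>) > s)
           \<le> TB_par M X Y C t s"
    unfolding TB_par_def using assms by (intro Max_ge) (auto simp: finite_image_distinct_pairs C)
qed

text \<open>Nonnegativity, witnessed by the inserted \<open>0\<close>, allows cardinalities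
  multiplying these parameters to be replaced by larger bounds.\<close>

lemma T_par_nonneg: "TA_par M X Y C t s \<ge> 0" "TB_par M X Y C t s \<ge> 0"
proof -
  show "TA_par M X Y C t s \<ge> 0" "TB_par M X Y C t s \<ge> 0"
    unfolding TA_par_def TB_par_def by ((intro Max_ge; auto simp: finite_image_distinct_pairs C)+)
qed

text \<open>The hypothesis \<open>TB\<close> counts only Bob's actual competitors, the other
  codewords in the colour class of \<open>v\<close>, so the argument is independent of how the class
  sizes are bounded.\<close>

lemma prob_agree_ge:
  assumes TA: "real (card C) * TA_par M X Y C t s \<le> 1 / 4"
    and TB: "\<And>v. v \<in> C \<Longrightarrow>
      real (card ({w \<in> C. col w = col v} - {v})) * TB_par M X Y C t s \<le> 1 / 4"
  shows "\<P>(\<omega> in M. alice_output C enc t \<kappa>A (X \<omega>)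
             = bob_output C enc col s \<kappa>B (alice_message C col t (X \<omega>)) (Y \<omega>))
           \<ge> 1 / 2 * real (card C) * B_par M X Y C t s"
proof -
  \<comment> \<open>\<open>P v\<close> is a confusion on Alice's side and \<open>R v\<close> one on
    Bob's side; \<open>G v\<close> is the part of \<open>E v\<close> on which both parties decode
    \<open>v\<close>.\<close>
  define E where "E = (\<lambda>v \<omega>. inner v (X \<omega>) > t \<and> inner v (Y \<omega>) > s)"
  define P where "P = (\<lambda>v \<omega>. \<exists>w\<in>C - {v}. inner w (X \<omega>) > t)"
  define R where "R = (\<lambda>v \<omega>. \<exists>w\<in>{w \<in> C. col w = col v} - {v}. inner w (Y \<omega>) > s)"
  define G where "G = (\<lambda>v. {\<omega>\<in>space M. E v \<omega> \<and> \<not> P v \<omega> \<and> \<not> R v \<omega>})"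
  let ?S = "{\<omega>\<in>space M. alice_output C enc t \<kappa>A (X \<omega>)
             = bob_output C enc col s \<kappa>B (alice_message C col t (X \<omega>)) (Y \<omega>)}"
  have E [measurable]: "Measurable.pred M (E v)" for v
    unfolding E_def by measurable
  have PR [measurable]: "Measurable.pred M (P v)" "Measurable.pred M (R v)" for v
    unfolding P_def R_def using C by (auto intro!: pred_intros_finite pred_gt)
  have G [measurable]: "G v \<in> events" for v
    unfolding G_def by measurable
  have S: "?S \<in> events"
    using pred_eq_count_space[OF finite_bitstrings measurable_alice_output
        measurable_bob_output] by (simp add: pred_def)
  have GE: "prob (G v) \<ge> 1 / 2 * B_par M X Y C t s" if v: "v \<in> C" for v
  proof -
    have "\<P>(\<omega> in M. E v \<omega> \<and> P v \<omega>)
        \<le> real (card (C - {v})) * TA_par M X Y C t s * \<P>(\<omega> in M. E v \<omega>)"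
      unfolding P_def using C v
      by (intro prob_conj_Bex_le E pred_gt) (auto simp: E_def intro: cond_prob_le_par)
    also have "\<dots> \<le> 1 / 4 * \<P>(\<omega> in M. E v \<omega>)"
    proof (intro mult_right_mono)
      \<comment> \<open>The union bound runs over \<open>C - {v}\<close>, while \<open>TA\<close> is
        stated with all of \<open>C\<close>.\<close>
      have "real (card (C - {v})) * TA_par M X Y C t s \<le> real (card C) * TA_par M X Y C t s"
        using C by (intro mult_right_mono T_par_nonneg of_nat_mono card_mono) auto
      with TA show "real (card (C - {v})) * TA_par M X Y C t s \<le> 1 / 4" by linarith
    qed simp
    finally have 1: "\<P>(\<omega> in M. E v \<omega> \<and> P v \<omega>) \<le> 1 / 4 * \<P>(\<omega> in M. E v \<omega>)" .
    have "\<P>(\<omega> in M. E v \<omega> \<and> R v \<omega>)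
        \<le> real (card ({w \<in> C. col w = col v} - {v})) * TB_par M X Y C t s * \<P>(\<omega> in M. E v \<omega>)"
      unfolding R_def using C v
      by (intro prob_conj_Bex_le E pred_gt) (auto simp: E_def intro: cond_prob_le_par)
    also have "\<dots> \<le> 1 / 4 * \<P>(\<omega> in M. E v \<omega>)"
      by (intro mult_right_mono TB v) simp
    finally have 2: "\<P>(\<omega> in M. E v \<omega> \<and> R v \<omega>) \<le> 1 / 4 * \<P>(\<omega> in M. E v \<omega>)" .
    have "B_par M X Y C t s \<le> \<P>(\<omega> in M. E v \<omega>)"
      unfolding B_par_def E_def using C v by (intro Min_le) auto
    \<comment> \<open>Removing two parts of weight at most \<open>1/4\<close> each leaves half of
      the probability of \<open>E v\<close>; this is the source of the factor
      \<open>1/2\<close>.\<close>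
    with 1 2 prob_conj_not_not_ge[OF E[of v] PR[of v]] show ?thesis
      unfolding G_def by linarith
  qed
  \<comment> \<open>On \<open>G v\<close> no other codeword exceeds \<open>t\<close> against
    \<open>X\<close>, but on \<open>G w\<close> the codeword \<open>w\<close> does.\<close>
  have disj: "disjoint_family_on G C"
    unfolding disjoint_family_on_def G_def E_def P_def by blast
  have "1 / 2 * real (card C) * B_par M X Y C t s = (\<Sum>v\<in>C. 1 / 2 * B_par M X Y C t s)"
    by simp
  also have "\<dots> \<le> (\<Sum>v\<in>C. prob (G v))"
    by (intro sum_mono GE)
  also have "\<dots> = prob (\<Union>v\<in>C. G v)"
    using C disj by (intro finite_measure_finite_Union[symmetric]) auto
  also have "\<dots> \<le> prob ?S"
  proof (rule finite_measure_mono[OF _ S], safe)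
    fix v \<omega> assume "v \<in> C" "\<omega> \<in> G v"
    then show "\<omega> \<in> space M" "alice_output C enc t \<kappa>A (X \<omega>)
             = bob_output C enc col s \<kappa>B (alice_message C col t (X \<omega>)) (Y \<omega>)"
      using scheme_agrees[of v C t "X \<omega>" s "Y \<omega>" col]
      unfolding G_def E_def P_def R_def by auto
  qed
  finally show ?thesis .
qed

end

section \<open>From the balanced coloring to the two bounds\<close>

theorem theorem2p1:
  fixes M :: "'a measure" and \<mu> :: "(real \<times> real) measure"
    and X Y :: "'a \<Rightarrow> real^'n"
    and C :: "(real^'n) set" and k :: nat and enc :: "real^'n \<Rightarrow> bool list"
    and c :: real and Col :: "'c set" and col :: "real^'n \<Rightarrow> 'c"
    and t s :: real and \<kappa>A \<kappa>B :: "real^'n \<Rightarrow> bool list"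
  assumes "prob_space \<mu>" and "sets \<mu> = sets borel"
    and "prob_space M"
    and "prob_space.indep_vars M (\<lambda>_. borel) (\<lambda>i \<omega>. (X \<omega> $ i, Y \<omega> $ i)) UNIV"
    and "\<And>i. distr M borel (\<lambda>\<omega>. (X \<omega> $ i, Y \<omega> $ i)) = \<mu>"
    and "finite C" and "card C = 2 ^ k"
    and "inj_on enc C" and "enc ` C \<subseteq> bitstrings k"
    and "c \<ge> 0"
    and "finite Col" and "real (card Col) = 2 powr c" and "col ` C \<subseteq> Col"
    and "\<And>\<tau>. \<tau> \<in> Col \<Longrightarrow> real (card {v \<in> C. col v = \<tau>}) \<le> real (card C) * 2 powr (- c) + 1"
    and "\<And>x. \<kappa>A x \<in> bitstrings k" and "\<And>y. \<kappa>B y \<in> bitstrings k"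
    and "uniform_rv M (bitstrings k) (\<lambda>\<omega>. \<kappa>A (X \<omega>))"
    and "uniform_rv M (bitstrings k) (\<lambda>\<omega>. \<kappa>B (Y \<omega>))"
  shows "min_entropy M (bitstrings k) (\<lambda>\<omega>. alice_output C enc t \<kappa>A (X \<omega>))
           \<ge> - log 2 (U_par M X C t + 2 powr (- real k)) \<and>
         (real (card C) * TA_par M X Y C t s \<le> 1 / 4 \<longrightarrow>
          real (card C) * TB_par M X Y C t s \<le> 1 / 4 * 2 powr c \<longrightarrow>
          \<P>(\<omega> in M. alice_output C enc t \<kappa>A (X \<omega>)
                   = bob_output C enc col s \<kappa>B (alice_message C col t (X \<omega>)) (Y \<omega>))
            \<ge> 1 / 2 * real (card C) * B_par M X Y C t s)"
proof -
  interpret prob_space M by fact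
  \<comment> \<open>Measurability of each coordinate pair is part of
    \<open>indep_vars\<close>.\<close>
  have "(\<lambda>\<omega>. (X \<omega> $ i, Y \<omega> $ i)) \<in> borel_measurable M" for i
    using assms(4) by (auto simp: indep_vars_def)
  note XY = borel_measurable_vec_pair[OF this]
  interpret one_way_scheme M X Y C k enc col t s \<kappa>A \<kappa>B
    using XY assms by unfold_locales auto
  have "real (card ({w \<in> C. col w = col v} - {v})) * TB_par M X Y C t s \<le> 1 / 4"
    if TB: "real (card C) * TB_par M X Y C t s \<le> 1 / 4 * 2 powr c" and v: "v \<in> C" for v
  proof -
    \<comment> \<open>Since \<open>v\<close> lies in its own colour class, deleting it lowers the
      size by exactly one, which cancels the \<open>+ 1\<close> in the class size bound.\<close>
    have "real (card ({w \<in> C. col w = col v} - {v})) = real (card {w \<in> C. col w = col v}) - 1"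
      using \<open>finite C\<close> v card_Suc_Diff1[of "{w \<in> C. col w = col v}" v] by simp
    also have "\<dots> \<le> real (card C) * 2 powr (- c)"
      using assms(14)[of "col v"] assms(13) v by auto
    finally have "real (card ({w \<in> C. col w = col v} - {v})) * TB_par M X Y C t s
        \<le> real (card C) * 2 powr (- c) * TB_par M X Y C t s"
      by (intro mult_right_mono T_par_nonneg)
    \<comment> \<open>The factor \<open>2 powr (- c)\<close> from the class size cancels the
      \<open>2 powr c\<close> allowed in Bob's hypothesis.\<close>
    also have "\<dots> \<le> 1 / 4"
      using TB by (simp add: powr_minus field_simps)
    finally show ?thesis .
  qed
  then show ?thesis
    using min_entropy_ge[OF finite_bitstrings measurable_alice_output prob_alice_output_le]
      prob_agree_ge by blast
qed

end
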